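(* Let $n,r\ge 1$ be integers and let $A,B_1,\dots,B_n,C$ be matrices in $\mathbb{C}^{r\times r}$ such that $C+kI$ is invertible for all integers $k\ge 0$, and such that $B_iB_j=B_jB_i$ and $CB_j=B_jC$ for all $i,j=1,\dots,n$. Then the matrix function $U=F_{\mathcal{D}}[A,B_1,\dots,B_n;C;x_1,\dots,x_n]$ satisfies, on the interior of the region of absolute convergence of its defining series, the system of partial matrix differential equations $$x_i(1-x_i)\,U_{x_ix_i}+\sum_{\substack{j=1\\ j\ne i}}^{n} x_j(1-x_i)\,U_{x_ix_j}-(A+I)x_iU_{x_i}+U_{x_i}C-\Big(\sum_{j=1}^{n}x_jU_{x_j}\Big)B_i-A\,U\,B_i=0,\qquad i=1,\dots,n.$$
   Context: For $M\in\mathbb{C}^{r\times r}$, the Pochhammer symbol is $(M)_0=I$ and $(M)_k=M(M+I)\cdots(M+(k-1)I)$ for $k\ge1$; $(M)_k^{-1}$ denotes the inverse matrix of $(M)_k$. Matrix products are taken in the written order. For complex variables $x_1,\dots,x_n$, $$F_{\mathcal{D}}[A,B_1,\dots,B_n;C;x_1,\dots,x_n]=\sum_{m_1,\dots,m_n=0}^{\infty}(A)_{m_1+\cdots+m_n}(B_1)_{m_1}\cdots(B_n)_{m_n}(C)_{m_1+\cdots+m_n}^{-1}\,\frac{x_1^{m_1}\cdots x_n^{m_n}}{m_1!\cdots m_n!}.$$ Subscripts denote partial derivatives: $U_{x_i}=\partial U/\partial x_i$, $U_{x_ix_j}=\partial^2U/\partial x_i\partial x_j$. *)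

theory Defs
  imports "HOL-Analysis.Analysis"
begin

text \<open>Multiplication of a complex matrix by a complex scalar; the library's \<open>*\<^sub>R\<close> only covers
  real scalars.\<close>

definition cscale :: "complex \<Rightarrow> complex ^ 'c ^ 'r \<Rightarrow> complex ^ 'c ^ 'r"  (infixr "\<odot>" 75)
  where "c \<odot> M = (\<chi> p q. c * M $ p $ q)"

text \<open>The library's \<open>pochhammer\<close> is restricted to commutative semirings.\<close>

primrec mpochhammer :: "complex ^ 'r ^ 'r \<Rightarrow> nat \<Rightarrow> complex ^ 'r ^ 'r"
  where
    "mpochhammer M 0 = mat 1"
  | "mpochhammer M (Suc k) = mpochhammer M k ** (M + mat (of_nat k))"

text \<open>The variables are indexed by a finite linearly ordered type, which plays the role of
  \<open>{1, \<dots>, n}\<close>; the order is only needed to fix the order of factors in the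
  noncommutative product \<open>M\<^sub>1 \<dots> M\<^sub>n\<close>.\<close>

definition mprod :: "('n::{finite,linorder} \<Rightarrow> complex ^ 'r ^ 'r) \<Rightarrow> complex ^ 'r ^ 'r"
  where "mprod M = foldr (\<lambda>i P. M i ** P) (sorted_list_of_set UNIV) (mat 1)"

definition FD_term ::
  "complex ^ 'r ^ 'r \<Rightarrow> ('n::{finite,linorder} \<Rightarrow> complex ^ 'r ^ 'r) \<Rightarrow> complex ^ 'r ^ 'r
    \<Rightarrow> complex ^ ('n::{finite,linorder}) \<Rightarrow> ('n \<Rightarrow> nat) \<Rightarrow> complex ^ 'r ^ 'r"
  where
    "FD_term A B C x m =
       ((\<Prod>i\<in>UNIV. x $ i ^ m i) / (\<Prod>i\<in>UNIV. fact (m i))) \<odot>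
         (mpochhammer A (\<Sum>i\<in>UNIV. m i) ** mprod (\<lambda>i. mpochhammer (B i) (m i))
           ** matrix_inv (mpochhammer C (\<Sum>i\<in>UNIV. m i)))"

definition FD ::
  "complex ^ 'r ^ 'r \<Rightarrow> ('n::{finite,linorder} \<Rightarrow> complex ^ 'r ^ 'r) \<Rightarrow> complex ^ 'r ^ 'r
    \<Rightarrow> complex ^ ('n::{finite,linorder}) \<Rightarrow> complex ^ 'r ^ 'r"
  where "FD A B C x = (\<Sum>\<^sub>\<infinity>m\<in>UNIV. FD_term A B C x m)"

text \<open>The norm on matrices is the Frobenius norm; all norms give the same region.\<close>

definition FD_region ::
  "complex ^ 'r ^ 'r \<Rightarrow> ('n::{finite,linorder} \<Rightarrow> complex ^ 'r ^ 'r) \<Rightarrow> complex ^ 'r ^ 'r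
    \<Rightarrow> (complex ^ ('n::{finite,linorder})) set"
  where "FD_region A B C = {x. (\<lambda>m. norm (FD_term A B C x m)) summable_on UNIV}"

text \<open>Complex partial derivatives of matrix functions are taken entrywise. Since \<open>deriv\<close> is total,
  existence is expressed separately by \<open>pdifferentiable\<close>.\<close>

definition upd :: "'a ^ 'n \<Rightarrow> 'n::finite \<Rightarrow> 'a \<Rightarrow> 'a ^ 'n"
  where "upd x i z = (\<chi> k. if k = i then z else x $ k)"

definition pdifferentiable ::
  "'n::finite \<Rightarrow> (complex ^ 'n \<Rightarrow> complex ^ 'r ^ 'r) \<Rightarrow> complex ^ 'n \<Rightarrow> bool"
  where "pdifferentiable i U x \<longleftrightarrow>
    (\<forall>p q. (\<lambda>z. U (upd x i z) $ p $ q) field_differentiable (at (x $ i)))"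

definition pderivative ::
  "'n::finite \<Rightarrow> (complex ^ 'n \<Rightarrow> complex ^ 'r ^ 'r) \<Rightarrow> complex ^ 'n \<Rightarrow> complex ^ 'r ^ 'r"
  where "pderivative i U x = (\<chi> p q. deriv (\<lambda>z. U (upd x i z) $ p $ q) (x $ i))"

end

theory Submission
  imports Defs
begin

text \<open>Around an interior point \<open>x\<close> of the region of absolute convergence there is an open polydisc
  on which \<open>U\<close> is the sum of an absolutely convergent power series with coefficients \<open>K m\<close>
  (lemma \<open>represents_FD\<close>). Such functions are closed under linear combinations, under
  multiplication by constant matrices on either side, under partial differentiation, which acts by
  \<open>(\<partial>\<^sub>i K) m = (m\<^sub>i + 1) K (m + e\<^sub>i)\<close> (lemma \<open>represents_pderivative\<close>), and under
  \<open>x\<^sub>i \<partial>\<^sub>i\<close>, which multiplies the coefficient at \<open>m\<close> by \<open>m\<^sub>i\<close> (lemma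
  \<open>represents_coordinate_mult\<close>). So the left-hand side of the differential equation is a power
  series too, and it vanishes as soon as its coefficients do.

  Let \<open>N\<close> be the total degree of \<open>m\<close>. The second-order terms combine to \<open>(1 - x\<^sub>i) W\<close> with
  \<open>W = (\<Sum>j. x\<^sub>j \<partial>\<^sub>i \<partial>\<^sub>j U)\<close>. The coefficient of \<open>W\<close> is \<open>N (\<partial>\<^sub>i K) m\<close>. Since \<open>m + e\<^sub>i\<close> has degree
  \<open>N + 1\<close>, this is also the coefficient of the \<open>i\<close>-th derivative of the series
  with coefficients \<open>(N - 1) K m\<close>, so the coefficient of \<open>x\<^sub>i W\<close> is \<open>m\<^sub>i (N - 1) K m\<close>. The whole
  left-hand side then has the coefficient
  \<open>(\<partial>\<^sub>i K) m (C + N) - (A + N) K m (B\<^sub>i + m\<^sub>i)\<close>, which is zero by the recurrence of the Pochhammer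
  symbols (lemma \<open>FD_coeff_recurrence\<close>). Only this last step uses the hypotheses on the matrices:
  commutativity moves the new factors to the outer sides of the product.\<close>

section \<open>Scalar multiples of complex matrices\<close>

lemma cscale_nth [simp]: "(c \<odot> M) $ p $ q = c * M $ p $ q"
  by (simp add: cscale_def)

lemma cscale_cscale [simp]: "a \<odot> (b \<odot> M) = (a * b) \<odot> M"
  by (simp add: vec_eq_iff)

lemma cscale_one [simp]: "1 \<odot> M = M"
  by (simp add: vec_eq_iff)

lemma cscale_zero [simp]: "0 \<odot> M = 0" "c \<odot> 0 = 0"
  by (simp_all add: vec_eq_iff)

lemma cscale_add_left: "(a + b) \<odot> M = a \<odot> M + b \<odot> M"
  by (simp add: vec_eq_iff algebra_simps)

lemma cscale_diff_left: "(a - b) \<odot> M = a \<odot> M - b \<odot> M"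
  by (simp add: vec_eq_iff algebra_simps)

lemma cscale_add_right: "c \<odot> (M + N) = c \<odot> M + c \<odot> N"
  by (simp add: vec_eq_iff algebra_simps)

lemma cscale_diff_right: "c \<odot> (M - N) = c \<odot> M - c \<odot> N"
  by (simp add: vec_eq_iff algebra_simps)

lemma cscale_sum_left: "(\<Sum>j\<in>S. f j) \<odot> M = (\<Sum>j\<in>S. f j \<odot> M)"
  by (induction S rule: infinite_finite_induct) (auto simp: cscale_add_left)

lemma cscale_sum_right: "c \<odot> (\<Sum>j\<in>S. f j) = (\<Sum>j\<in>S. c \<odot> f j)"
  by (induction S rule: infinite_finite_induct) (auto simp: cscale_add_right)

lemma norm_cscale: "norm (c \<odot> M) = cmod c * norm M"
  by (simp add: norm_vec_def norm_mult L2_set_right_distrib)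

lemma matrix_mul_cscale_left: "(c \<odot> M) ** N = c \<odot> (M ** N)"
  by (simp add: vec_eq_iff matrix_matrix_mult_def sum_distrib_left mult.assoc)

lemma matrix_mul_cscale_right: "M ** (c \<odot> N) = c \<odot> (M ** N)"
  by (simp add: vec_eq_iff matrix_matrix_mult_def sum_distrib_left mult_ac)

lemma scaleR_eq_cscale: "a *\<^sub>R M = complex_of_real a \<odot> M"
  by (simp add: vec_eq_iff) (simp add: scaleR_conv_of_real)

lemma mat_eq_cscale: "mat c = c \<odot> mat 1"
  by (simp add: vec_eq_iff mat_def)

lemma bounded_linear_cscale: "bounded_linear (\<lambda>M. c \<odot> M)"
  unfolding linear_conv_bounded_linear [symmetric]
  by (rule linearI) (simp_all add: cscale_add_right scaleR_eq_cscale mult.commute)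

lemma bounded_linear_matrix_mul_left: "bounded_linear (\<lambda>M :: complex ^ 'c ^ 'b. A ** M)"
  unfolding linear_conv_bounded_linear [symmetric]
  by (rule linearI) (simp_all add: matrix_add_ldistrib scaleR_eq_cscale matrix_mul_cscale_right)

lemma matrix_add_rdistrib:
  fixes L :: "complex ^ 'b ^ 'a"
  shows "(L + M) ** N = L ** N + M ** N"
  by (simp add: vec_eq_iff matrix_matrix_mult_def sum.distrib algebra_simps)

lemma bounded_linear_matrix_mul_right: "bounded_linear (\<lambda>M :: complex ^ 'b ^ 'a. M ** A)"
  unfolding linear_conv_bounded_linear [symmetric]
  by (rule linearI) (simp_all add: matrix_add_rdistrib scaleR_eq_cscale matrix_mul_cscale_left)

section \<open>Matrix-valued power series in several variables\<close>

definition mpower :: "complex ^ 'n \<Rightarrow> ('n::finite \<Rightarrow> nat) \<Rightarrow> complex"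
  where "mpower x m = (\<Prod>i\<in>UNIV. x $ i ^ m i)"

definition polydisc :: "('n::finite \<Rightarrow> real) \<Rightarrow> (complex ^ 'n) set"
  where "polydisc r = {x. \<forall>k. cmod (x $ k) < r k}"

text \<open>\<open>V\<close> is the sum of the power series with matrix coefficients \<open>K\<close> on the open polydisc
  of polyradius \<open>r\<close>. Absolute convergence is part of the notion because differentiating and
  rearranging the series need it. Restricting the points to the polydisc makes the
  notion insensitive to the arbitrary values that \<^const>\<open>pderivative\<close> takes elsewhere.\<close>

definition represents ::
  "('n::finite \<Rightarrow> real) \<Rightarrow> (complex ^ 'n \<Rightarrow> complex ^ 'c ^ 'r) \<Rightarrow> (('n \<Rightarrow> nat) \<Rightarrow> complex ^ 'c ^ 'r)
    \<Rightarrow> bool"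
  where "represents r V K \<longleftrightarrow>
    (\<forall>x\<in>polydisc r. (\<lambda>m. norm (mpower x m \<odot> K m)) summable_on UNIV \<and>
       ((\<lambda>m. mpower x m \<odot> K m) has_sum V x) UNIV)"

text \<open>The coefficients of the formal partial derivative of a power series.\<close>

definition deriv_coeff ::
  "'n \<Rightarrow> (('n \<Rightarrow> nat) \<Rightarrow> complex ^ 'c ^ 'r) \<Rightarrow> ('n \<Rightarrow> nat) \<Rightarrow> complex ^ 'c ^ 'r"
  where "deriv_coeff i K m = of_nat (Suc (m i)) \<odot> K (m(i := Suc (m i)))"

lemma representsD:
  assumes "represents r V K" "x \<in> polydisc r"
  shows "(\<lambda>m. norm (mpower x m \<odot> K m)) summable_on UNIV"
    and "((\<lambda>m. mpower x m \<odot> K m) has_sum V x) UNIV"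
  using assms by (auto simp: represents_def)

lemma inj_increment: "inj (\<lambda>m :: 'n \<Rightarrow> nat. m(i := Suc (m i)))"
proof (rule injI, rule ext)
  fix m m' :: "'n \<Rightarrow> nat" and k
  assume "m(i := Suc (m i)) = m'(i := Suc (m' i))"
  hence "(m(i := Suc (m i))) k = (m'(i := Suc (m' i))) k" by simp
  thus "m k = m' k" by (auto split: if_splits)
qed

text \<open>Evaluating at the point with \<open>i\<close>-th coordinate \<open>1\<close> removes the factor
  \<open>x $ i ^ m i\<close>; this expresses the monomial in the other variables without leaving the
  type of points.\<close>

lemma mpower_split:
  fixes x :: "complex ^ 'n"
  shows "mpower x m = x $ i ^ m i * mpower (upd x i 1) m"
proof -
  have "mpower x m = x $ i ^ m i * (\<Prod>k\<in>UNIV - {i}. x $ k ^ m k)" for x :: "complex ^ 'n"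
    unfolding mpower_def by (subst prod.remove[of _ i]) auto
  moreover have "(\<Prod>k\<in>UNIV - {i}. upd x i 1 $ k ^ m k) = (\<Prod>k\<in>UNIV - {i}. x $ k ^ m k)"
    by (intro prod.cong) (auto simp: upd_def)
  ultimately show ?thesis
    by (simp add: upd_def)
qed

lemma mpower_upd_one_fun_upd: "mpower (upd x i 1) (m(i := k)) = mpower (upd x i 1) m"
  unfolding mpower_def by (intro prod.cong) (auto simp: upd_def)

lemma mpower_fun_upd_Suc: "mpower x (m(i := Suc (m i))) = x $ i * mpower x m"
  using mpower_split[of x m i] mpower_split[of x "m(i := Suc (m i))" i]
  by (simp add: mpower_upd_one_fun_upd)

lemma cmod_mpower: "cmod (mpower x m) = (\<Prod>i\<in>UNIV. cmod (x $ i) ^ m i)"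
  by (simp add: mpower_def prod_norm [symmetric] norm_power)

lemma cmod_mpower_le:
  assumes "\<And>k. cmod (x $ k) \<le> cmod (y $ k)"
  shows "cmod (mpower x m) \<le> cmod (mpower y m)"
  unfolding cmod_mpower by (intro prod_mono) (auto intro: power_mono assms)

lemma upd_upd [simp]: "upd (upd x i a) i b = upd x i b"
  by (simp add: upd_def vec_eq_iff)

lemma upd_nth [simp]: "upd x i z $ k = (if k = i then z else x $ k)"
  by (simp add: upd_def)

lemma upd_polydisc: "x \<in> polydisc r \<Longrightarrow> cmod z < r i \<Longrightarrow> upd x i z \<in> polydisc r"
  by (simp add: polydisc_def)

lemma represents_eqI:
  assumes "represents r V K" "\<And>x. x \<in> polydisc r \<Longrightarrow> V' x = V x" "\<And>m. K' m = K m"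
  shows "represents r V' K'"
proof -
  have "K' = K" using assms(3) by blast
  thus ?thesis using assms(1,2) by (auto simp: represents_def)
qed

lemma represents_infsum:
  assumes "\<And>x. x \<in> polydisc r \<Longrightarrow> (\<lambda>m. norm (mpower x m \<odot> K m)) summable_on UNIV"
  shows "represents r (\<lambda>x. \<Sum>\<^sub>\<infinity>m. mpower x m \<odot> K m) K"
  unfolding represents_def using has_sum_infsum[OF abs_summable_summable[OF assms]] assms by simp

lemma represents_zero: "represents r (\<lambda>_. 0) (\<lambda>_. 0)"
  by (simp add: represents_def)

lemma represents_unique_zero:
  assumes "represents r V (\<lambda>_. 0)" "x \<in> polydisc r"
  shows "V x = 0"
  using representsD(2)[OF assms] has_sum_unique[OF _ has_sum_0[of UNIV "\<lambda>_. 0"]]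
  by fastforce

lemma represents_linear:
  assumes V: "represents r V K" and f: "bounded_linear f" and scale: "\<And>c M. f (c \<odot> M) = c \<odot> f M"
  shows "represents r (\<lambda>x. f (V x)) (\<lambda>m. f (K m))"
  unfolding represents_def
proof (intro ballI conjI)
  fix x assume x: "x \<in> polydisc r"
  show "((\<lambda>m. mpower x m \<odot> f (K m)) has_sum f (V x)) UNIV"
    using has_sum_bounded_linear[OF f representsD(2)[OF V x]] by (simp add: scale)
  obtain B where B: "\<And>M. norm (f M) \<le> norm M * B"
    using bounded_linear.bounded[OF f] by blast
  show "(\<lambda>m. norm (mpower x m \<odot> f (K m))) summable_on UNIV"
    using B by (intro Infinite_Sum.abs_summable_on_comparison_test'
        [OF summable_on_cmult_left[OF representsD(1)[OF V x]]]) (simp add: scale [symmetric])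
qed

lemma represents_add:
  assumes V: "represents r V K" and W: "represents r W L"
  shows "represents r (\<lambda>x. V x + W x) (\<lambda>m. K m + L m)"
  unfolding represents_def
proof (intro ballI conjI)
  fix x assume x: "x \<in> polydisc r"
  show "((\<lambda>m. mpower x m \<odot> (K m + L m)) has_sum (V x + W x)) UNIV"
    using has_sum_add[OF representsD(2)[OF V x] representsD(2)[OF W x]]
    by (simp add: cscale_add_right)
  show "(\<lambda>m. norm (mpower x m \<odot> (K m + L m))) summable_on UNIV"
    by (intro Infinite_Sum.abs_summable_on_comparison_test'
        [OF summable_on_add[OF representsD(1)[OF V x] representsD(1)[OF W x]]])
      (simp add: cscale_add_right norm_triangle_ineq)
qed

lemma represents_cscale:
  "represents r V K \<Longrightarrow> represents r (\<lambda>x. c \<odot> V x) (\<lambda>m. c \<odot> K m)"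
  by (erule represents_linear) (simp_all add: bounded_linear_cscale mult.commute)

lemma represents_matrix_mul_left:
  "represents r V K \<Longrightarrow> represents r (\<lambda>x. A ** V x) (\<lambda>m. A ** K m)"
  by (erule represents_linear) (simp_all add: bounded_linear_matrix_mul_left matrix_mul_cscale_right)

lemma represents_matrix_mul_right:
  "represents r V K \<Longrightarrow> represents r (\<lambda>x. V x ** A) (\<lambda>m. K m ** A)"
  by (erule represents_linear) (simp_all add: bounded_linear_matrix_mul_right matrix_mul_cscale_left)

lemma represents_diff:
  assumes "represents r V K" and "represents r W L"
  shows "represents r (\<lambda>x. V x - W x) (\<lambda>m. K m - L m)"
  using represents_add[OF assms(1) represents_cscale[OF assms(2), of "-1"]]
  by (rule represents_eqI) (simp_all add: vec_eq_iff)

lemma represents_sum: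
  assumes "\<And>j. j \<in> S \<Longrightarrow> represents r (V j) (K j)"
  shows "represents r (\<lambda>x. \<Sum>j\<in>S. V j x) (\<lambda>m. \<Sum>j\<in>S. K j m)"
  using assms
  by (induction S rule: infinite_finite_induct) (simp_all add: represents_zero represents_add)

text \<open>Multiplying by \<open>x $ i\<close> shifts the index back, which undoes the shift in
  \<^const>\<open>deriv_coeff\<close> and leaves the Euler factor \<open>m i\<close>; the terms with \<open>m i = 0\<close> that the shift
  misses are killed by this factor.\<close>

lemma represents_coordinate_mult:
  assumes V: "represents r V (deriv_coeff i K)"
  shows "represents r (\<lambda>x. x $ i \<odot> V x) (\<lambda>m. of_nat (m i) \<odot> K m)"
  unfolding represents_def
proof (intro ballI)
  fix x assume x: "x \<in> polydisc r"
  let ?h = "\<lambda>m. m(i := Suc (m i))"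
  let ?g = "\<lambda>m. mpower x m \<odot> (of_nat (m i) \<odot> K m)"
  have inj: "inj ?h" by (rule inj_increment)
  have zero: "?g m = 0" if "m \<notin> range ?h" for m
  proof (cases "m i")
    case (Suc k)
    hence "m = ?h (m(i := k))" by auto
    thus ?thesis using that by blast
  qed simp
  have g_h: "?g (?h m) = x $ i \<odot> (mpower x m \<odot> deriv_coeff i K m)" for m
    by (simp add: mpower_fun_upd_Suc deriv_coeff_def mult_ac)
  hence comp: "?g \<circ> ?h = (\<lambda>m. x $ i \<odot> (mpower x m \<odot> deriv_coeff i K m))"
    by (simp only: o_def)
  have "((?g \<circ> ?h) has_sum x $ i \<odot> V x) UNIV"
    unfolding comp by (rule has_sum_bounded_linear[OF bounded_linear_cscale representsD(2)[OF V x]])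
  hence "(?g has_sum x $ i \<odot> V x) (range ?h)"
    by (simp add: has_sum_reindex[OF inj])
  hence sum: "(?g has_sum x $ i \<odot> V x) UNIV"
    by (rule has_sum_cong_neutral[THEN iffD1, rotated 3]) (use zero in auto)
  have "((\<lambda>m. norm (?g m)) \<circ> ?h) = (\<lambda>m. cmod (x $ i) * norm (mpower x m \<odot> deriv_coeff i K m))"
    unfolding o_def g_h by (rule ext, rule norm_cscale)
  hence "((\<lambda>m. norm (?g m)) \<circ> ?h) summable_on UNIV"
    by (simp only: summable_on_cmult_right[OF representsD(1)[OF V x]])
  hence "(\<lambda>m. norm (?g m)) summable_on range ?h"
    by (simp only: summable_on_reindex[OF inj])
  hence "(\<lambda>m. norm (?g m)) summable_on UNIV"
    by (rule summable_on_cong_neutral[THEN iffD1, rotated 3]) (use zero in auto)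
  with sum show "(\<lambda>m. norm (?g m)) summable_on UNIV \<and> (?g has_sum x $ i \<odot> V x) UNIV" by blast
qed

section \<open>Termwise partial differentiation\<close>

lemma Suc_times_power_bounded:
  fixes q :: real
  assumes "0 \<le> q" "q < 1"
  obtains C where "\<And>n. real (Suc n) * q ^ n \<le> C"
proof -
  have "(\<lambda>n. of_nat n * q ^ n + q ^ n) \<longlonglongrightarrow> 0 + 0"
    using assms by (intro tendsto_add powser_times_n_limit_0 LIMSEQ_power_zero) auto
  hence "Bseq (\<lambda>n. of_nat n * q ^ n + q ^ n)"
    by (intro convergent_imp_Bseq convergentI)
  then obtain C where C: "\<And>n. norm (of_nat n * q ^ n + q ^ n) \<le> C"
    unfolding Bseq_def by blast
  hence "real (Suc n) * q ^ n \<le> C" for n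
    using order_trans[OF abs_ge_self C[of n, unfolded real_norm_def]] by (simp add: distrib_right)
  thus ?thesis by (rule that)
qed

text \<open>The point \<open>x\<close> leaves room for a point \<open>y\<close> of the polydisc whose coordinates have strictly larger
  moduli. The factor \<open>m i + 1\<close> is absorbed by the geometric decay of
  \<open>(cmod (x $ i) / cmod (y $ i)) ^ m i\<close>, so the derived series at \<open>x\<close> is dominated by the
  original series at \<open>y\<close>.\<close>

lemma summable_deriv_coeff:
  assumes V: "represents r V K" and x: "x \<in> polydisc r"
  shows "(\<lambda>m. norm (mpower x m \<odot> deriv_coeff i K m)) summable_on UNIV"
proof -
  (* The midpoint between the modulus of the coordinate and the radius; it is positive even where
     the coordinate vanishes. *)
  define s where "s k = (cmod (x $ k) + r k) / 2" for k
  define y :: "complex ^ 'a" where "y = (\<chi> k. of_real (s k))"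
  have r: "cmod (x $ k) < r k" for k using x by (simp add: polydisc_def)
  have xs: "cmod (x $ k) < s k" and sr: "s k < r k" for k
    using r[of k] by (simp_all add: s_def)
  have s0: "0 < s k" for k
    using norm_ge_zero[of "x $ k"] xs[of k] by (rule order.strict_trans1)
  have cy: "cmod (y $ k) = s k" for k
    using s0[of k] by (simp add: y_def)
  have y: "y \<in> polydisc r" using sr by (simp add: polydisc_def cy)
  define q where "q = cmod (x $ i) / s i"
  have q: "0 \<le> q" "q < 1" using s0[of i] xs[of i] by (auto simp: q_def)
  obtain C where C: "\<And>n. real (Suc n) * q ^ n \<le> C"
    using Suc_times_power_bounded[OF q] by blast
  let ?h = "\<lambda>m. m(i := Suc (m i))"
  have inj: "inj ?h" by (rule inj_increment)
  have "(\<lambda>m. norm (mpower y m \<odot> K m)) summable_on range ?h"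
    using representsD(1)[OF V y] by (rule summable_on_subset_banach) simp
  hence "(\<lambda>m. norm (mpower y (?h m) \<odot> K (?h m))) summable_on UNIV"
    by (simp add: summable_on_reindex[OF inj] o_def)
  hence "(\<lambda>m. C / s i * norm (mpower y (?h m) \<odot> K (?h m))) summable_on UNIV"
    by (rule summable_on_cmult_right)
  thus ?thesis
  proof (rule Infinite_Sum.abs_summable_on_comparison_test')
    fix m
    have "cmod (mpower (upd x i 1) m) \<le> cmod (mpower (upd y i 1) m)"
      by (rule cmod_mpower_le) (simp add: cy less_imp_le[OF xs])
    moreover have bound: "real (Suc (m i)) * cmod (x $ i) ^ m i \<le> C * s i ^ m i"
      using C[of "m i"] s0[of i] by (simp add: q_def power_divide field_simps)
    ultimately have "real (Suc (m i)) * cmod (x $ i) ^ m i * cmod (mpower (upd x i 1) m)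
        \<le> C * s i ^ m i * cmod (mpower (upd y i 1) m)"
      by (intro mult_mono[OF bound] order_trans[OF _ bound]) simp_all
    hence "real (Suc (m i)) * cmod (mpower x m) \<le> C * cmod (mpower y m)"
      by (simp add: mpower_split[of x m i] mpower_split[of y m i] norm_mult norm_power cy mult_ac)
    hence "real (Suc (m i)) * cmod (mpower x m) * norm (K (?h m)) \<le> C * cmod (mpower y m) * norm (K (?h m))"
      by (intro mult_right_mono) auto
    thus "norm (mpower x m \<odot> deriv_coeff i K m) \<le> C / s i * norm (mpower y (?h m) \<odot> K (?h m))"
      using s0[of i]
      by (simp add: norm_cscale deriv_coeff_def mpower_fun_upd_Suc norm_mult cy mult_ac del: of_nat_Suc)
  qed
qed

text \<open>For fixed values of the other variables, a power series in several variables is a power series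
  in the \<open>i\<close>-th variable alone. This is its \<open>k\<close>-th coefficient: the sum over all multi-indices
  with \<open>i\<close>-th entry \<open>k\<close>, indexed by those with \<open>i\<close>-th entry \<open>0\<close>.\<close>

definition slice_coeff :: "complex ^ 'n \<Rightarrow> 'n::finite \<Rightarrow> (('n \<Rightarrow> nat) \<Rightarrow> complex) \<Rightarrow> nat \<Rightarrow> complex"
  where "slice_coeff x i c k = (\<Sum>\<^sub>\<infinity>m\<in>{m. m i = 0}. c (m(i := k)) * mpower (upd x i 1) m)"

text \<open>Unordered summation allows summing over the \<open>i\<close>-th entry last. If \<open>x $ i = 0\<close> and \<open>k > 0\<close>,
  the inner sum may diverge, and \<^const>\<open>slice_coeff\<close> is then the default value \<open>0\<close>; this is harmless
  because the factor \<open>x $ i ^ k\<close> vanishes.\<close>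

lemma slice_sums:
  assumes "((\<lambda>m. mpower x m * c m) has_sum S) UNIV"
  shows "(\<lambda>k. slice_coeff x i c k * x $ i ^ k) sums S"
proof -
  let ?f = "\<lambda>(k, m). x $ i ^ k * (c (m(i := k)) * mpower (upd x i 1) m)"
  let ?M = "{m :: 'a \<Rightarrow> nat. m i = 0}"
  have "(?f has_sum S) (UNIV \<times> ?M) \<longleftrightarrow> ((\<lambda>m. mpower x m * c m) has_sum S) UNIV"
    by (rule has_sum_reindex_bij_witness
        [where i = "\<lambda>m. (m i, m(i := 0))" and j = "\<lambda>(k, m). m(i := k)"])
      (auto simp: fun_eq_iff mpower_split[of x _ i] mpower_upd_one_fun_upd mult_ac)
  hence f: "(?f has_sum S) (UNIV \<times> ?M)" using assms by blast
  have "((\<lambda>m. ?f (k, m)) has_sum x $ i ^ k * slice_coeff x i c k) ?M" for k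
  proof -
    have "(\<lambda>m. ?f (k, m)) summable_on ?M"
      using summable_on_SigmaD1[of "\<lambda>k m. ?f (k, m)" UNIV "\<lambda>_. ?M" k] has_sum_imp_summable[OF f]
      by (simp add: case_prod_unfold)
    hence "((\<lambda>m. ?f (k, m)) has_sum (\<Sum>\<^sub>\<infinity>m\<in>?M. ?f (k, m))) ?M"
      by (rule has_sum_infsum)
    thus ?thesis by (simp add: infsum_cmult_right' slice_coeff_def)
  qed
  hence "((\<lambda>k. x $ i ^ k * slice_coeff x i c k) has_sum S) UNIV"
    by (rule has_sum_SigmaD[OF f])
  thus ?thesis by (simp add: has_sum_imp_sums mult.commute)
qed

lemma slice_coeff_upd: "slice_coeff (upd x i z) i c = slice_coeff x i c"
  by (rule ext) (simp add: slice_coeff_def)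

text \<open>Slicing turns the formal partial derivative into the formal derivative of a power series in one
  variable.\<close>

lemma slice_coeff_deriv:
  "slice_coeff x i (\<lambda>m. deriv_coeff i K m $ p $ q) = diffs (slice_coeff x i (\<lambda>m. K m $ p $ q))"
  by (rule ext)
    (simp add: slice_coeff_def diffs_def deriv_coeff_def infsum_cmult_right' [symmetric] mult.assoc
      del: of_nat_Suc)

lemma represents_entry_sums:
  assumes "represents r V K" "x \<in> polydisc r"
  shows "(\<lambda>k. slice_coeff x i (\<lambda>m. K m $ p $ q) k * x $ i ^ k) sums (V x $ p $ q)"
proof (rule slice_sums)
  have "bounded_linear (\<lambda>M :: complex ^ 'b ^ 'c. M $ p $ q)"
    by (intro bounded_linear_compose[OF bounded_linear_vec_nth] bounded_linear_vec_nth)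
  from has_sum_bounded_linear[OF this representsD(2)[OF assms]]
  show "((\<lambda>m. mpower x m * K m $ p $ q) has_sum V x $ p $ q) UNIV" by simp
qed

text \<open>Termwise partial differentiation reduces to the theorem for power series in one variable: slice
  the series, differentiate, and recognise the result as the slice of the derived series, which
  converges absolutely and may therefore be summed in any order.\<close>

lemma represents_has_field_derivative:
  assumes V: "represents r V K" and x: "x \<in> polydisc r"
  shows "((\<lambda>z. V (upd x i z) $ p $ q) has_field_derivative
    (\<Sum>\<^sub>\<infinity>m. mpower x m \<odot> deriv_coeff i K m) $ p $ q) (at (x $ i))"
proof -
  let ?c = "slice_coeff x i (\<lambda>m. K m $ p $ q)"
  have s: "(\<lambda>k. ?c k * z ^ k) sums (V (upd x i z) $ p $ q)" if "cmod z < r i" for z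
    using represents_entry_sums[OF V upd_polydisc[OF x that], of i p q]
    by (simp add: slice_coeff_upd)
  have xi: "cmod (x $ i) < r i" using x by (simp add: polydisc_def)
  have "((\<lambda>z. \<Sum>k. ?c k * z ^ k) has_field_derivative (\<Sum>k. diffs ?c k * (x $ i) ^ k)) (at (x $ i))"
    using s xi by (intro termdiffs_strong'[of "r i"]) (auto simp: sums_iff)
  hence deriv: "((\<lambda>z. V (upd x i z) $ p $ q) has_field_derivative (\<Sum>k. diffs ?c k * (x $ i) ^ k))
      (at (x $ i))"
    by (rule has_field_derivative_transform_within_open[of _ _ _ "ball 0 (r i)"])
      (use s xi in \<open>auto simp: sums_iff\<close>)
  define D where "D = (\<lambda>x. \<Sum>\<^sub>\<infinity>m. mpower x m \<odot> deriv_coeff i K m)"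
  have "represents r D (deriv_coeff i K)"
    unfolding D_def by (intro represents_infsum summable_deriv_coeff[OF V])
  from represents_entry_sums[OF this x, of i p q]
  have "(\<Sum>k. diffs ?c k * (x $ i) ^ k) = D x $ p $ q"
    by (simp add: slice_coeff_deriv sums_iff)
  with deriv show ?thesis by (simp add: D_def)
qed

lemma represents_pdifferentiable:
  assumes "represents r V K" "x \<in> polydisc r"
  shows "pdifferentiable i V x"
  unfolding pdifferentiable_def field_differentiable_def
  using represents_has_field_derivative[OF assms] by blast

lemma represents_pderivative:
  assumes V: "represents r V K"
  shows "represents r (pderivative i V) (deriv_coeff i K)"
proof -
  have "pderivative i V x = (\<Sum>\<^sub>\<infinity>m. mpower x m \<odot> deriv_coeff i K m)" if "x \<in> polydisc r" for x
    using DERIV_imp_deriv[OF represents_has_field_derivative[OF V that]]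
    by (simp add: pderivative_def vec_eq_iff)
  with represents_infsum[OF summable_deriv_coeff[OF V]] show ?thesis
    by (rule represents_eqI) simp_all
qed

text \<open>The equality of mixed partial derivatives, on the level of coefficients.\<close>

lemma deriv_coeff_commute: "deriv_coeff i (deriv_coeff j K) = deriv_coeff j (deriv_coeff i K)"
  by (rule ext, cases "i = j") (auto simp: deriv_coeff_def fun_upd_twist mult_ac)

section \<open>The matrix function as a power series on a polydisc\<close>

definition FD_coeff ::
  "complex ^ 'r ^ 'r \<Rightarrow> ('n::{finite,linorder} \<Rightarrow> complex ^ 'r ^ 'r) \<Rightarrow> complex ^ 'r ^ 'r
    \<Rightarrow> ('n \<Rightarrow> nat) \<Rightarrow> complex ^ 'r ^ 'r"
  where
    "FD_coeff A B C m =
       (1 / (\<Prod>i\<in>UNIV. fact (m i))) \<odot>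
         (mpochhammer A (\<Sum>i\<in>UNIV. m i) ** mprod (\<lambda>i. mpochhammer (B i) (m i))
           ** matrix_inv (mpochhammer C (\<Sum>i\<in>UNIV. m i)))"

lemma FD_term_eq: "FD_term A B C x m = mpower x m \<odot> FD_coeff A B C m"
  by (simp add: FD_term_def FD_coeff_def mpower_def)

text \<open>The region contains with a point every point whose coordinates have smaller moduli. Moving
  from an interior point \<open>x\<close> a little outwards in every coordinate (for a zero coordinate, in any direction) gives a point \<open>y\<close> of the
  region with strictly larger moduli, and the series at \<open>y\<close> dominates it on the whole polydisc
  of polyradius \<open>cmod (y $ k)\<close>, which contains \<open>x\<close>.\<close>

lemma represents_FD:
  fixes x :: "complex ^ ('n::{finite,linorder})"
  assumes "x \<in> interior (FD_region A B C)"
  obtains r where "x \<in> polydisc r" "represents r (FD A B C) (FD_coeff A B C)"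
proof -
  obtain e where e: "e > 0" "ball x e \<subseteq> FD_region A B C"
    using assms by (auto simp: mem_interior)
  define v :: "complex ^ ('n::{finite,linorder})" where "v = (\<chi> k. if x $ k = 0 then 1 else sgn (x $ k))"
  define t where "t = e / (2 * (norm v + 1))"
  have t: "t > 0" using e by (simp add: t_def add_nonneg_pos)
  define y where "y = x + t *\<^sub>R v"
  have "t * norm v \<le> t * (norm v + 1)" using t by simp
  also have "\<dots> = e / 2"
  proof -
    have "norm v + 1 \<noteq> 0" using norm_ge_zero[of v] by linarith
    thus ?thesis by (simp add: t_def field_simps)
  qed
  also have "\<dots> < e" using e by simp
  finally have "y \<in> ball x e" using t by (simp add: y_def dist_norm)
  hence y: "(\<lambda>m. norm (FD_term A B C y m)) summable_on UNIV"
    using e by (auto simp: FD_region_def)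
  have less: "cmod (x $ k) < cmod (y $ k)" for k
  proof (cases "x $ k = 0")
    case False
    hence "v $ k = x $ k / of_real (cmod (x $ k))"
      by (simp add: v_def sgn_eq)
    moreover have "y $ k = x $ k + of_real t * v $ k"
      unfolding y_def vector_add_component vector_scaleR_component
      by (simp only: scaleR_conv_of_real)
    ultimately have "y $ k = complex_of_real (1 + t / cmod (x $ k)) * x $ k"
      by (simp add: distrib_right)
    hence "cmod (y $ k) = \<bar>1 + t / cmod (x $ k)\<bar> * cmod (x $ k)"
      by (simp only: norm_mult norm_of_real)
    also have "\<dots> = (1 + t / cmod (x $ k)) * cmod (x $ k)"
      using t by (simp add: add_pos_nonneg)
    also have "\<dots> = cmod (x $ k) + t" using False by (simp add: distrib_right)
    finally show ?thesis using t by simp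
  qed (use t in \<open>simp add: y_def v_def\<close>)
  define r where "r = (\<lambda>k. cmod (y $ k))"
  have "represents r (FD A B C) (FD_coeff A B C)"
    unfolding FD_def [abs_def] FD_term_eq
  proof (rule represents_infsum, rule Infinite_Sum.abs_summable_on_comparison_test'[OF y])
    fix w m assume w: "w \<in> polydisc r"
    have "cmod (mpower w m) \<le> cmod (mpower y m)"
      using w by (intro cmod_mpower_le less_imp_le) (simp add: polydisc_def r_def)
    thus "norm (mpower w m \<odot> FD_coeff A B C m) \<le> norm (FD_term A B C y m)"
      by (simp add: FD_term_eq norm_cscale mult_right_mono)
  qed
  moreover have "x \<in> polydisc r" using less by (simp add: polydisc_def r_def)
  ultimately show ?thesis by (rule that[rotated])
qed

section \<open>The recurrence of the coefficients\<close>

lemma commute_add_mat: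
  fixes X M :: "complex ^ 'r ^ 'r"
  assumes "X ** M = M ** X"
  shows "X ** (M + mat c) = (M + mat c) ** X"
  by (simp add: matrix_add_ldistrib matrix_add_rdistrib assms mat_eq_cscale[of c]
      matrix_mul_cscale_left matrix_mul_cscale_right)

lemma commute_matrix_mul:
  fixes X M N :: "complex ^ 'r ^ 'r"
  assumes "X ** M = M ** X" "X ** N = N ** X"
  shows "X ** (M ** N) = (M ** N) ** X"
  by (metis assms matrix_mul_assoc)

lemma commute_mpochhammer:
  assumes "X ** M = M ** X"
  shows "X ** mpochhammer M k = mpochhammer M k ** X"
  by (induction k) (simp_all add: commute_matrix_mul commute_add_mat assms)

lemma
  fixes M :: "complex ^ 'r ^ 'r"
  assumes "invertible M"
  shows matrix_inv_right: "M ** matrix_inv M = mat 1"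
    and matrix_inv_left: "matrix_inv M ** M = mat 1"
  using someI_ex[OF assms[unfolded invertible_def]] by (simp_all add: matrix_inv_def)

lemma invertible_mpochhammer:
  assumes "\<And>k::nat. invertible (C + mat (of_nat k))"
  shows "invertible (mpochhammer C k)"
  by (induction k) (simp_all add: invertible_mult assms, metis invertible_def matrix_mul_lid)

text \<open>The recursion of \<^const>\<open>mpochhammer\<close> puts the new factor of the inverse on the left; it can be
  cancelled from the right because all factors of \<open>(C)\<^sub>k\<close> are polynomials in \<open>C\<close> and commute.\<close>

lemma matrix_inv_mpochhammer_Suc:
  assumes C: "\<And>k::nat. invertible (C + mat (of_nat k))"
  shows "matrix_inv (mpochhammer C (Suc k)) ** (C + mat (of_nat k)) = matrix_inv (mpochhammer C k)"
proof -
  let ?P = "mpochhammer C k" and ?P' = "mpochhammer C (Suc k)" and ?X = "C + mat (of_nat k)"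
  have comm: "?X ** ?P = ?P ** ?X"
    by (intro commute_mpochhammer commute_add_mat [symmetric]) simp
  have "matrix_inv ?P' ** ?X ** ?P = matrix_inv ?P' ** ?P'"
    by (simp add: comm matrix_mul_assoc [symmetric])
  also have "\<dots> = mat 1"
    by (rule matrix_inv_left[OF invertible_mpochhammer[OF C]])
  finally have "matrix_inv ?P' ** ?X ** ?P ** matrix_inv ?P = matrix_inv ?P" by simp
  thus ?thesis
    by (simp only: matrix_mul_assoc [symmetric] matrix_inv_right[OF invertible_mpochhammer[OF C]]
        matrix_mul_rid)
qed

lemma commute_matrix_inv:
  fixes X P :: "complex ^ 'r ^ 'r"
  assumes "X ** P = P ** X" "invertible P"
  shows "X ** matrix_inv P = matrix_inv P ** X"
proof -
  have "matrix_inv P ** (X ** P) ** matrix_inv P = matrix_inv P ** (P ** X) ** matrix_inv P"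
    by (simp only: assms(1))
  thus ?thesis
    by (metis assms(2) matrix_inv_left matrix_inv_right matrix_mul_assoc matrix_mul_lid matrix_mul_rid)
qed

text \<open>The new factor appears in the middle of the product, at the position of \<open>i\<close>. It can be moved
  to the far right because it commutes with every factor.\<close>

lemma foldr_matrix_mul_update:
  fixes G :: "'n \<Rightarrow> complex ^ 'r ^ 'r"
  assumes "\<And>j. X ** G j = G j ** X" "distinct xs" "i \<in> set xs"
  shows "foldr (\<lambda>j P. (G(i := G i ** X)) j ** P) xs (mat 1) = foldr (\<lambda>j P. G j ** P) xs (mat 1) ** X"
  using assms(2,3)
proof (induction xs)
  case (Cons a xs)
  have comm: "X ** foldr (\<lambda>j P. G j ** P) xs (mat 1) = foldr (\<lambda>j P. G j ** P) xs (mat 1) ** X" for xs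
    by (induction xs) (simp_all add: commute_matrix_mul assms(1))
  have same: "foldr (\<lambda>j P. (G(i := G i ** X)) j ** P) xs (mat 1) = foldr (\<lambda>j P. G j ** P) xs (mat 1)"
    if "i \<notin> set xs"
    using that by (intro foldr_cong) auto
  show ?case
  proof (cases "a = i")
    case True
    with Cons.prems have "i \<notin> set xs" by auto
    with True show ?thesis
      using same by (simp add: comm matrix_mul_assoc [symmetric])
  next
    case False
    with Cons show ?thesis by (simp add: matrix_mul_assoc)
  qed
qed simp

lemma mprod_mpochhammer_Suc:
  fixes B :: "'n::{finite,linorder} \<Rightarrow> complex ^ 'r ^ 'r"
  assumes BB: "\<And>i j. B i ** B j = B j ** B i"
  shows "mprod (\<lambda>j. mpochhammer (B j) ((m(i := Suc (m i))) j)) =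
    mprod (\<lambda>j. mpochhammer (B j) (m j)) ** (B i + mat (of_nat (m i)))"
proof -
  let ?G = "\<lambda>j. mpochhammer (B j) (m j)" and ?X = "B i + mat (of_nat (m i))"
  have G: "(\<lambda>j. mpochhammer (B j) ((m(i := Suc (m i))) j)) = ?G(i := ?G i ** ?X)"
    by (rule ext) simp
  have "?X ** ?G j = ?G j ** ?X" for j
    by (intro commute_mpochhammer commute_add_mat [symmetric] BB)
  thus ?thesis
    unfolding G mprod_def by (rule foldr_matrix_mul_update) simp_all
qed

text \<open>Passing from \<open>m\<close> to \<open>m + e\<^sub>i\<close> multiplies \<open>(A)\<^sub>N\<close> by \<open>A + N\<close>, the product of the
  \<open>(B\<^sub>j)\<close> by \<open>B\<^sub>i + m\<^sub>i\<close> and \<open>(C)\<^sub>N\<close> by \<open>C + N\<close>, where \<open>N\<close> is the total degree of \<open>m\<close>; the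
  factorials contribute \<open>m\<^sub>i + 1\<close>, which is the factor in \<^const>\<open>deriv_coeff\<close>. The factor
  \<open>A + N\<close> commutes with \<open>(A)\<^sub>N\<close> and moves to the far left, and \<open>B\<^sub>i + m\<^sub>i\<close> moves to the far right
  past the inverse of \<open>(C)\<^sub>N\<close> because \<open>B\<^sub>i\<close> commutes with \<open>C\<close>. This is why, in the
  differential equation, \<open>A\<close> multiplies from the left and \<open>B\<^sub>i\<close> and \<open>C\<close> from the right.\<close>

lemma FD_coeff_recurrence:
  fixes A C :: "complex ^ 'r ^ 'r" and B :: "'n::{finite,linorder} \<Rightarrow> complex ^ 'r ^ 'r"
  assumes C_inv: "\<And>k::nat. invertible (C + mat (of_nat k))"
    and BB: "\<And>i j. B i ** B j = B j ** B i"
    and CB: "\<And>j. C ** B j = B j ** C"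
  defines "K \<equiv> FD_coeff A B C"
  shows "deriv_coeff i K m ** (C + mat (of_nat (\<Sum>k\<in>UNIV. m k))) =
    (A + mat (of_nat (\<Sum>k\<in>UNIV. m k))) ** K m ** (B i + mat (of_nat (m i)))"
proof -
  let ?N = "\<Sum>k\<in>UNIV. m k" and ?m' = "m(i := Suc (m i))"
  let ?PA = "mpochhammer A ?N" and ?PB = "mprod (\<lambda>j. mpochhammer (B j) (m j))"
    and ?J = "matrix_inv (mpochhammer C ?N)" and ?J' = "matrix_inv (mpochhammer C (Suc ?N))"
    and ?F = "\<Prod>k\<in>UNIV. fact (m k) :: complex"
    and ?XA = "A + mat (of_nat ?N)" and ?XB = "B i + mat (of_nat (m i))"
    and ?XC = "C + mat (of_nat ?N)"
  have N': "(\<Sum>k\<in>UNIV. ?m' k) = Suc ?N"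
    by (simp add: sum.remove[of UNIV i])
  have F': "(\<Prod>k\<in>UNIV. fact (?m' k) :: complex) = of_nat (Suc (m i)) * ?F"
    by (simp add: prod.remove[of UNIV i] mult_ac)
  have scalar: "of_nat (Suc (m i)) * (1 / (of_nat (Suc (m i)) * ?F)) = 1 / ?F"
    by (simp del: of_nat_Suc)
  have cA: "?XA ** ?PA = ?PA ** ?XA"
    by (intro commute_mpochhammer commute_add_mat [symmetric]) simp
  have "?XB ** C = C ** ?XB"
    by (rule commute_add_mat [symmetric]) (simp add: CB)
  hence cC: "?XB ** ?J = ?J ** ?XB"
    by (intro commute_matrix_inv commute_mpochhammer invertible_mpochhammer C_inv)
  have "K ?m' = (1 / (of_nat (Suc (m i)) * ?F)) \<odot> (?PA ** ?XA ** (?PB ** ?XB) ** ?J')"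
    unfolding K_def FD_coeff_def N' F'
    by (subst mprod_mpochhammer_Suc[of B, OF BB]) (simp only: mpochhammer.simps)
  hence "deriv_coeff i K m = (1 / ?F) \<odot> (?PA ** ?XA ** (?PB ** ?XB) ** ?J')"
    unfolding deriv_coeff_def by (simp only: cscale_cscale scalar)
  hence "deriv_coeff i K m ** ?XC = (1 / ?F) \<odot> (?PA ** ?XA ** (?PB ** ?XB) ** (?J' ** ?XC))"
    by (simp only: matrix_mul_cscale_left matrix_mul_assoc)
  also have "\<dots> = (1 / ?F) \<odot> (?XA ** ?PA ** ?PB ** (?XB ** ?J))"
    by (simp only: matrix_inv_mpochhammer_Suc[OF C_inv] cA matrix_mul_assoc)
  also have "\<dots> = ?XA ** K m ** ?XB"
    by (simp only: K_def FD_coeff_def cC matrix_mul_cscale_left matrix_mul_cscale_right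
        matrix_mul_assoc)
  finally show ?thesis .
qed

section \<open>The system of differential equations\<close>

theorem theorem3p4:
  fixes A C :: "complex ^ 'r ^ 'r"
    and B :: "'n::{finite,linorder} \<Rightarrow> complex ^ 'r ^ 'r"
    and U :: "complex ^ ('n::{finite,linorder}) \<Rightarrow> complex ^ 'r ^ 'r"
    and x :: "complex ^ ('n::{finite,linorder})"
  assumes C_inv: "\<And>k::nat. invertible (C + mat (of_nat k))"
    and BB: "\<And>i j. B i ** B j = B j ** B i"
    and CB: "\<And>j. C ** B j = B j ** C"
    and U: "U = FD A B C"
    and x: "x \<in> interior (FD_region A B C)"
  shows "(\<forall>i. pdifferentiable i U x) \<and>
    (\<forall>i j. pdifferentiable i (pderivative j U) x) \<and>
    (\<forall>i. (x $ i * (1 - x $ i)) \<odot> pderivative i (pderivative i U) x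
        + (\<Sum>j\<in>UNIV - {i}. (x $ j * (1 - x $ i)) \<odot> pderivative i (pderivative j U) x)
        - (A + mat 1) ** (x $ i \<odot> pderivative i U x)
        + pderivative i U x ** C
        - (\<Sum>j\<in>UNIV. x $ j \<odot> pderivative j U x) ** B i
        - A ** U x ** B i = 0)"
proof -
  define K where "K = FD_coeff A B C"
  obtain r where xr: "x \<in> polydisc r" and UK: "represents r U K"
    using represents_FD[OF x] unfolding U K_def by blast
  define N :: "('n \<Rightarrow> nat) \<Rightarrow> complex" where "N m = of_nat (\<Sum>k\<in>UNIV. m k)" for m
  have N_sum: "N m = (\<Sum>k\<in>UNIV. of_nat (m k))" for m by (simp add: N_def)
  have Ui: "represents r (pderivative i U) (deriv_coeff i K)" for i
    by (rule represents_pderivative[OF UK])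
  have Euler: "represents r (\<lambda>x. \<Sum>j\<in>UNIV. x $ j \<odot> pderivative j U x) (\<lambda>m. N m \<odot> K m)"
    by (rule represents_eqI[OF represents_sum[OF represents_coordinate_mult[OF Ui]]])
      (simp_all add: N_sum cscale_sum_left)
  have pde: "(x $ i * (1 - x $ i)) \<odot> pderivative i (pderivative i U) x
        + (\<Sum>j\<in>UNIV - {i}. (x $ j * (1 - x $ i)) \<odot> pderivative i (pderivative j U) x)
        - (A + mat 1) ** (x $ i \<odot> pderivative i U x)
        + pderivative i U x ** C
        - (\<Sum>j\<in>UNIV. x $ j \<odot> pderivative j U x) ** B i
        - A ** U x ** B i = 0" for i
  proof -
    define W where "W y = (\<Sum>j\<in>UNIV. y $ j \<odot> pderivative i (pderivative j U) y)" for y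
    (* Factor the mixed derivative through the j-th one, so that multiplication by the j-th
       coordinate becomes the Euler factor. *)
    have "represents r (pderivative i (pderivative j U)) (deriv_coeff j (deriv_coeff i K))" for j
      unfolding deriv_coeff_commute[of j i] by (rule represents_pderivative[OF Ui])
    note represents_sum[of UNIV, OF represents_coordinate_mult[OF this]]
    hence W: "represents r W (\<lambda>m. N m \<odot> deriv_coeff i K m)"
      by (rule represents_eqI) (simp_all add: W_def N_sum cscale_sum_left)
    have N_shift: "N (m(i := Suc (m i))) = N m + 1" for m
      by (simp add: N_sum sum.remove[of UNIV i])
    (* Multiplication by the i-th coordinate is only understood for a series that is an i-th
       derivative. *)
    have "(\<lambda>m. N m \<odot> deriv_coeff i K m) = deriv_coeff i (\<lambda>m. (N m - 1) \<odot> K m)"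
      by (rule ext) (simp add: deriv_coeff_def N_shift mult.commute)
    hence xW: "represents r (\<lambda>y. y $ i \<odot> W y) (\<lambda>m. of_nat (m i) \<odot> ((N m - 1) \<odot> K m))"
      using W by (intro represents_coordinate_mult) simp
    have "N m \<odot> deriv_coeff i K m - of_nat (m i) \<odot> ((N m - 1) \<odot> K m)
        - (A + mat 1) ** (of_nat (m i) \<odot> K m) + deriv_coeff i K m ** C
        - (N m \<odot> K m) ** B i - A ** K m ** B i = 0" (is "?Z m = 0") for m
    proof -
      have "?Z m = deriv_coeff i K m ** (C + mat (N m))
          - (A + mat (N m)) ** K m ** (B i + mat (of_nat (m i)))"
        by (simp add: matrix_add_ldistrib matrix_add_rdistrib mat_eq_cscale[of "N m"]
            mat_eq_cscale[of "of_nat (m i)"] matrix_mul_cscale_left matrix_mul_cscale_right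
            cscale_add_right cscale_diff_left cscale_diff_right algebra_simps)
      thus ?thesis
        using FD_coeff_recurrence[where A = A and i = i and m = m, OF C_inv BB CB] by (simp add: K_def N_def)
    qed
    hence "represents r (\<lambda>y. W y - y $ i \<odot> W y - (A + mat 1) ** (y $ i \<odot> pderivative i U y)
        + pderivative i U y ** C - (\<Sum>j\<in>UNIV. y $ j \<odot> pderivative j U y) ** B i
        - A ** U y ** B i) (\<lambda>_. 0)"
      by (intro represents_eqI[OF represents_diff[OF represents_diff[OF represents_add[OF
            represents_diff[OF represents_diff[OF W xW]
              represents_matrix_mul_left[OF represents_coordinate_mult[OF Ui]]]
            represents_matrix_mul_right[OF Ui]] represents_matrix_mul_right[OF Euler]]
            represents_matrix_mul_right[OF represents_matrix_mul_left[OF UK]]]]) auto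
    from represents_unique_zero[OF this xr]
    have "W x - x $ i \<odot> W x - (A + mat 1) ** (x $ i \<odot> pderivative i U x)
        + pderivative i U x ** C - (\<Sum>j\<in>UNIV. x $ j \<odot> pderivative j U x) ** B i
        - A ** U x ** B i = 0" .
    moreover have "(x $ i * (1 - x $ i)) \<odot> pderivative i (pderivative i U) x
        + (\<Sum>j\<in>UNIV - {i}. (x $ j * (1 - x $ i)) \<odot> pderivative i (pderivative j U) x)
        = W x - x $ i \<odot> W x"
    proof -
      have "(x $ i * (1 - x $ i)) \<odot> pderivative i (pderivative i U) x
        + (\<Sum>j\<in>UNIV - {i}. (x $ j * (1 - x $ i)) \<odot> pderivative i (pderivative j U) x)
        = (\<Sum>j\<in>UNIV. (x $ j * (1 - x $ i)) \<odot> pderivative i (pderivative j U) x)"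
        by (simp add: sum.remove[of UNIV i])
      also have "\<dots> = (1 - x $ i) \<odot> W x"
        by (simp add: W_def cscale_sum_right mult.commute)
      also have "\<dots> = W x - x $ i \<odot> W x"
        by (simp add: cscale_diff_left)
      finally show ?thesis .
    qed
    ultimately show ?thesis by simp
  qed
  show ?thesis
    using represents_pdifferentiable[OF UK xr] represents_pdifferentiable[OF Ui xr] pde by blast
qed

end
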